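(* Let $\Sigma_1,\Sigma_2$ be systems as in the context, $\tilde n=n_1+n_2$, $Q_{i,\tilde n}=\mathcal{O}bs_{\tilde n}(A_i,C_i)$, and let $\mathcal R\subseteq\mathbb R^{n_1}\times\mathbb R^{n_2}$ be a subspace. Then $\Sigma_1$ and $\Sigma_2$ have equivalent stochastic external behavior with respect to $\mathcal R$ if and only if the following hold: $(p_0)$ $\Psi_1=\Psi_2$; $(p_1)$ $C_1A_1^tB_1=C_2A_2^tB_2$ for all $t\ge0$; $(p_2)$ $C_1A_1^tG_1\mu_1=C_2A_2^tG_2\mu_2$ for all $t\ge0$; $(p_3)$ $C_1A_1^kG_1G_1^T(A_1^h)^TC_1^T=C_2A_2^kG_2G_2^T(A_2^h)^TC_2^T$ for all $h,k\ge0$; and $(p_4)$ $\mathcal R\subseteq\ker([Q_{1,\tilde n}\ \ -Q_{2,\tilde n}])$. Moreover, if $\Sigma_1$ and $\Sigma_2$ have equivalent stochastic external behavior with respect to $\mathcal R$, there exists a $\mathrm{diag}(A_1,A_2)$-invariant subspace $\mathcal R'\supseteq\mathcal R$ such that $\Sigma_1$ and $\Sigma_2$ have equivalent stochastic external behavior with respect to $\mathcal R'$.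
   Context: For $i=1,2$, $\Sigma_i$ is the system $x_i(t+1)=A_ix_i(t)+B_iu(t)+G_iw_i(t)$, $y_i(t)=C_ix_i(t)+\nu_i(t)$, $t\in\mathbb{N}$, with $x_i\in\mathbb{R}^{n_i}$, $u\in\mathbb{R}^m$, $w_i\in\mathbb{R}^{l_i}$, $y_i,\nu_i\in\mathbb{R}^p$, where $(w_i(t))_t$ is i.i.d. with $w_i(t)\sim\mathcal N(\mu_i,I_{l_i})$, $(\nu_i(t))_t$ is i.i.d. with $\nu_i(t)\sim\mathcal N(0,\Psi_i)$, and the two sequences are mutually independent. For a deterministic initial state $x_i^0$ and deterministic input $\mathbf u:\mathbb N\to\mathbb R^m$, $\mathbf x_i|_{x_i^0,\mathbf u}(t)=A_i^tx_i^0+\sum_{\tau=0}^{t-1}A_i^{t-1-\tau}(B_iu(\tau)+G_iw_i(\tau))$, $\mathbf y_i|_{x_i^0,\mathbf u}(t)=C_i\mathbf x_i|_{x_i^0,\mathbf u}(t)+\nu_i(t)$. Processes are stochastically equivalent ($\sim$) if all finite-dimensional joint distributions coincide. For a subspace $\mathcal R\subseteq\mathbb R^{n_1}\times\mathbb R^{n_2}$, $\Sigma_1,\Sigma_2$ have equivalent stochastic external behavior with respect to $\mathcal R$ if $\mathbf y_1|_{x_1^0,\mathbf u}\sim\mathbf y_2|_{x_2^0,\mathbf u}$ for all $(x_1^0,x_2^0)\in\mathcal R$ and all inputs $\mathbf u$. $\mathcal{O}bs_k(A,C)$ is the matrix obtained by stacking $C,CA,\dots,CA^{k-1}$ vertically.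 $\mathrm{diag}(A_1,A_2)$ is the block-diagonal matrix. *)

theory Defs
  imports "HOL-Analysis.Analysis" "HOL-Probability.Probability"
begin

definition mpow :: "real^'n^'n \<Rightarrow> nat \<Rightarrow> real^'n^'n" where
  "mpow A t = ((\<lambda>X. A ** X) ^^ t) (mat 1)"

definition gaussian_vec :: "'a measure \<Rightarrow> ('a \<Rightarrow> real^'n) \<Rightarrow> real^'n \<Rightarrow> real^'n^'n \<Rightarrow> bool" where
  "gaussian_vec M X m S \<longleftrightarrow>
     X \<in> borel_measurable M \<and> transpose S = S \<and> (\<forall>u. 0 \<le> u \<bullet> (S *v u)) \<and>
     (\<forall>u. distr M borel (\<lambda>\<omega>. u \<bullet> X \<omega>) =
          (if u \<bullet> (S *v u) = 0 then return borel (u \<bullet> m)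
           else density lborel (\<lambda>x. ennreal (normal_density (u \<bullet> m) (sqrt (u \<bullet> (S *v u))) x))))"

definition noise_model :: "'a measure \<Rightarrow> (nat \<Rightarrow> 'a \<Rightarrow> real^'l) \<Rightarrow> (nat \<Rightarrow> 'a \<Rightarrow> real^'p)
    \<Rightarrow> real^'l \<Rightarrow> real^'p^'p \<Rightarrow> bool" where
  "noise_model M w \<nu> \<mu> \<Psi> \<longleftrightarrow>
     prob_space M \<and>
     (\<forall>t. gaussian_vec M (w t) \<mu> (mat 1)) \<and>
     (\<forall>t. gaussian_vec M (\<nu> t) 0 \<Psi>) \<and>
     prob_space.indep_vars M (\<lambda>_. borel) w UNIV \<and>
     prob_space.indep_vars M (\<lambda>_. borel) \<nu> UNIV \<and>
     prob_space.indep_set M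
       (sets (vimage_algebra (space M) (\<lambda>\<omega> t. w t \<omega>) (PiM UNIV (\<lambda>_. borel))))
       (sets (vimage_algebra (space M) (\<lambda>\<omega> t. \<nu> t \<omega>) (PiM UNIV (\<lambda>_. borel))))"

definition state_traj :: "real^'n^'n \<Rightarrow> real^'m^'n \<Rightarrow> real^'l^'n \<Rightarrow> (nat \<Rightarrow> 'a \<Rightarrow> real^'l)
    \<Rightarrow> real^'n \<Rightarrow> (nat \<Rightarrow> real^'m) \<Rightarrow> nat \<Rightarrow> 'a \<Rightarrow> real^'n" where
  "state_traj A B G w x0 u t \<omega> =
     mpow A t *v x0 + (\<Sum>\<tau><t. mpow A (t - 1 - \<tau>) *v (B *v u \<tau> + G *v w \<tau> \<omega>))"

definition output_traj :: "real^'n^'n \<Rightarrow> real^'m^'n \<Rightarrow> real^'l^'n \<Rightarrow> real^'n^'p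
    \<Rightarrow> (nat \<Rightarrow> 'a \<Rightarrow> real^'l) \<Rightarrow> (nat \<Rightarrow> 'a \<Rightarrow> real^'p)
    \<Rightarrow> real^'n \<Rightarrow> (nat \<Rightarrow> real^'m) \<Rightarrow> nat \<Rightarrow> 'a \<Rightarrow> real^'p" where
  "output_traj A B G C w \<nu> x0 u t \<omega> = C *v state_traj A B G w x0 u t \<omega> + \<nu> t \<omega>"

definition stoch_equiv :: "'a measure \<Rightarrow> (nat \<Rightarrow> 'a \<Rightarrow> real^'p) \<Rightarrow> 'b measure \<Rightarrow> (nat \<Rightarrow> 'b \<Rightarrow> real^'p) \<Rightarrow> bool" where
  "stoch_equiv M1 Y1 M2 Y2 \<longleftrightarrow>
     (\<forall>T. finite T \<longrightarrow>
        distr M1 (PiM T (\<lambda>_. borel)) (\<lambda>\<omega>. \<lambda>t\<in>T. Y1 t \<omega>) =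
        distr M2 (PiM T (\<lambda>_. borel)) (\<lambda>\<omega>. \<lambda>t\<in>T. Y2 t \<omega>))"

definition equiv_ext_beh where
  "equiv_ext_beh M1 A1 B1 G1 C1 w1 \<nu>1 M2 A2 B2 G2 C2 w2 \<nu>2 R \<longleftrightarrow>
     (\<forall>x1 x2 u. (x1, x2) \<in> R \<longrightarrow>
        stoch_equiv M1 (output_traj A1 B1 G1 C1 w1 \<nu>1 x1 u) M2 (output_traj A2 B2 G2 C2 w2 \<nu>2 x2 u))"

text \<open>(x1,x2) in ker [Obs_k(A1,C1)  -Obs_k(A2,C2)], written blockwise.\<close>
definition in_obs_ker :: "nat \<Rightarrow> real^'n1^'n1 \<Rightarrow> real^'n1^'p \<Rightarrow> real^'n2^'n2 \<Rightarrow> real^'n2^'p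
    \<Rightarrow> (real^'n1) \<times> (real^'n2) \<Rightarrow> bool" where
  "in_obs_ker k A1 C1 A2 C2 x \<longleftrightarrow>
     (\<forall>j<k. (C1 ** mpow A1 j) *v fst x - (C2 ** mpow A2 j) *v snd x = 0)"

definition diag_act :: "real^'n1^'n1 \<Rightarrow> real^'n2^'n2 \<Rightarrow> (real^'n1) \<times> (real^'n2) \<Rightarrow> (real^'n1) \<times> (real^'n2)" where
  "diag_act A1 A2 x = (A1 *v fst x, A2 *v snd x)"

end

theory Submission
  imports Defs
begin

text \<open>Finite-dimensional distributions are determined by the characteristic functions of all linear
  combinations \<open>\<Sum>t<n. c t \<bullet> y t\<close> of the outputs. By independence such a combination has characteristic
  function \<open>exp (\<i> m(c) - v(c) / 2)\<close>, where the mean \<open>m\<close> is linear and the variance \<open>v\<close> is quadratic in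
  \<open>c\<close>; rescaling \<open>c\<close> separates the two. Equality of the means, tested on zero state and zero input, on
  an impulse input, and on general states, yields \<open>(p\<^sub>1)\<close>, \<open>(p\<^sub>2)\<close> and \<open>(p\<^sub>4)\<close>. Polarising \<open>v\<close> gives the
  covariances of \<open>y s\<close> and \<open>y t\<close>; time zero yields \<open>\<Psi>\<^sub>1 = \<Psi>\<^sub>2\<close>, and the increments from \<open>(k, h)\<close> to
  \<open>(k + 1, h + 1)\<close> are the terms in \<open>(p\<^sub>3)\<close>. For the last claim take the whole kernel in \<open>(p\<^sub>4)\<close>.\<close>

subsection \<open>Uniqueness from characteristic functions\<close>

lemma integrable_bounded_iexp:
  fixes X f :: "'a \<Rightarrow> real"
  assumes "finite_measure M" "f \<in> borel_measurable M" "X \<in> borel_measurable M"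
    "\<And>\<omega>. \<bar>f \<omega>\<bar> \<le> K"
  shows "integrable M (\<lambda>\<omega>. f \<omega> *\<^sub>R iexp (X \<omega>))"
  by (rule finite_measure.integrable_const_bound[OF assms(1), where B = K]) (use assms in auto)

lemma weighted_Levy_uniqueness:
  fixes X f :: "'a \<Rightarrow> real" and Y g :: "'b \<Rightarrow> real"
  assumes fin: "finite_measure M" "finite_measure N"
    and [measurable]: "f \<in> borel_measurable M" "g \<in> borel_measurable N"
      "X \<in> borel_measurable M" "Y \<in> borel_measurable N" "A \<in> sets borel"
    and f: "\<And>\<omega>. 0 \<le> f \<omega>" "\<And>\<omega>. f \<omega> \<le> K" and g: "\<And>\<omega>. 0 \<le> g \<omega>" "\<And>\<omega>. g \<omega> \<le> L"
    and eq: "\<And>s. (\<integral>\<omega>. f \<omega> *\<^sub>R iexp (s * X \<omega>) \<partial>M) = (\<integral>\<omega>. g \<omega> *\<^sub>R iexp (s * Y \<omega>) \<partial>N)"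
  shows "(\<integral>\<omega>. f \<omega> * indicator A (X \<omega>) \<partial>M) = (\<integral>\<omega>. g \<omega> * indicator A (Y \<omega>) \<partial>N)"
proof -
  have intf: "integrable M f"
    by (rule finite_measure.integrable_const_bound[OF fin(1), where B = K]) (use f in auto)
  have intg: "integrable N g"
    by (rule finite_measure.integrable_const_bound[OF fin(2), where B = L]) (use g in auto)
  define c where "c = (\<integral>\<omega>. f \<omega> \<partial>M)"
  have "complex_of_real c = complex_of_real (\<integral>\<omega>. g \<omega> \<partial>N)"
    using eq[of 0] by (simp add: c_def scaleR_conv_of_real)
  then have c': "c = (\<integral>\<omega>. g \<omega> \<partial>N)" by (simp only: of_real_eq_iff)
  have c0: "0 \<le> c" unfolding c_def by (rule integral_nonneg_AE) (use f in auto)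
  show ?thesis
  proof (cases "c = 0")
    case True
    have "AE \<omega> in M. f \<omega> = 0"
      using integral_nonneg_eq_0_iff_AE[OF intf] f True c_def by auto
    then have "(\<integral>\<omega>. f \<omega> * indicator A (X \<omega>) \<partial>M) = 0"
      by (intro integral_eq_zero_AE) auto
    moreover have "AE \<omega> in N. g \<omega> = 0"
      using integral_nonneg_eq_0_iff_AE[OF intg] g True c' by auto
    then have "(\<integral>\<omega>. g \<omega> * indicator A (Y \<omega>) \<partial>N) = 0"
      by (intro integral_eq_zero_AE) auto
    ultimately show ?thesis by simp
  next
    case False
    with c0 have cpos: "0 < c" by simp
    define P where "P = density M (\<lambda>\<omega>. ennreal (f \<omega> / c))"
    define Q where "Q = density N (\<lambda>\<omega>. ennreal (g \<omega> / c))"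
    have [measurable_cong, simp]: "sets P = sets M" "sets Q = sets N"
      by (simp_all add: P_def Q_def)
    interpret P: prob_space P
    proof
      have "emeasure P (space P) = (\<integral>\<^sup>+\<omega>. ennreal (f \<omega> / c) \<partial>M)"
        unfolding P_def by (subst emeasure_density) (auto intro!: nn_integral_cong)
      also have "\<dots> = ennreal (\<integral>\<omega>. f \<omega> / c \<partial>M)"
        by (rule nn_integral_eq_integral) (use intf f cpos in auto)
      also have "\<dots> = 1" using cpos by (simp add: c_def)
      finally show "emeasure P (space P) = 1" .
    qed
    interpret Q: prob_space Q
    proof
      have "emeasure Q (space Q) = (\<integral>\<^sup>+\<omega>. ennreal (g \<omega> / c) \<partial>N)"
        unfolding Q_def by (subst emeasure_density) (auto intro!: nn_integral_cong)
      also have "\<dots> = ennreal (\<integral>\<omega>. g \<omega> / c \<partial>N)"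
        by (rule nn_integral_eq_integral) (use intg g cpos in auto)
      also have "\<dots> = 1" using cpos by (simp add: c')
      finally show "emeasure Q (space Q) = 1" .
    qed
    have PI: "integral\<^sup>L P h = (\<integral>\<omega>. f \<omega> *\<^sub>R h \<omega> \<partial>M) /\<^sub>R c"
      if [measurable]: "h \<in> borel_measurable M" for h :: "'a \<Rightarrow> 'c::{banach, second_countable_topology}"
    proof -
      have "integral\<^sup>L P h = (\<integral>\<omega>. (f \<omega> / c) *\<^sub>R h \<omega> \<partial>M)"
        unfolding P_def by (rule integral_density) (use f cpos in auto)
      also have "\<dots> = (\<integral>\<omega>. inverse c *\<^sub>R (f \<omega> *\<^sub>R h \<omega>) \<partial>M)"
        by (simp add: field_simps)
      finally show ?thesis by (simp only: integral_scaleR_right)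
    qed
    have QI: "integral\<^sup>L Q h = (\<integral>\<omega>. g \<omega> *\<^sub>R h \<omega> \<partial>N) /\<^sub>R c"
      if [measurable]: "h \<in> borel_measurable N" for h :: "'b \<Rightarrow> 'c::{banach, second_countable_topology}"
    proof -
      have "integral\<^sup>L Q h = (\<integral>\<omega>. (g \<omega> / c) *\<^sub>R h \<omega> \<partial>N)"
        unfolding Q_def by (rule integral_density) (use g cpos in auto)
      also have "\<dots> = (\<integral>\<omega>. inverse c *\<^sub>R (g \<omega> *\<^sub>R h \<omega>) \<partial>N)"
        by (simp add: field_simps)
      finally show ?thesis by (simp only: integral_scaleR_right)
    qed
    have "distr P borel X = distr Q borel Y"
    proof (rule Levy_uniqueness)
      show "real_distribution (distr P borel X)" by (rule P.real_distribution_distr) simp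
      show "real_distribution (distr Q borel Y)" by (rule Q.real_distribution_distr) simp
      show "char (distr P borel X) = char (distr Q borel Y)"
        by (rule ext) (simp add: char_def integral_distr PI QI eq[simplified])
    qed
    then have "(\<integral>x. indicator A x \<partial>distr P borel X) = (\<integral>x. indicator A x \<partial>distr Q borel Y :: real)"
      by simp
    then have "(\<integral>\<omega>. indicator A (X \<omega>) \<partial>P) = (\<integral>\<omega>. indicator A (Y \<omega>) \<partial>Q :: real)"
      by (subst (asm) (1 2) integral_distr) auto
    then show ?thesis using cpos by (simp add: PI QI)
  qed
qed

lemma iexp_cos_sin_product:
  "(2 + cos L) *\<^sub>R iexp x = 2 * iexp x + (1/2) * iexp (x + L) + (1/2) * iexp (x - L)"
  "(2 + sin L) *\<^sub>R iexp x = 2 * iexp x + (- \<i> / 2) * iexp (x + L) + (\<i> / 2) * iexp (x - L)"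
proof -
  have e: "iexp (x + L) = (cos L + \<i> * sin L) * iexp x" "iexp (x - L) = (cos L - \<i> * sin L) * iexp x"
    unfolding cis_conv_exp[symmetric] by (simp_all add: complex_eq_iff cos_add sin_add cos_diff sin_diff)
  have "2 * iexp x + (1/2) * iexp (x + L) + (1/2) * iexp (x - L) = (2 + cos L) * iexp x"
    unfolding e by (simp add: algebra_simps)
  then show "(2 + cos L) *\<^sub>R iexp x = 2 * iexp x + (1/2) * iexp (x + L) + (1/2) * iexp (x - L)"
    by (simp only: scaleR_conv_of_real)
  have i: "\<i> * \<i> = -1" by simp
  have "2 * iexp x + (- \<i> / 2) * iexp (x + L) + (\<i> / 2) * iexp (x - L) = (2 - (\<i> * \<i>) * sin L) * iexp x"
    unfolding e by (simp add: algebra_simps)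
  then show "(2 + sin L) *\<^sub>R iexp x = 2 * iexp x + (- \<i> / 2) * iexp (x + L) + (\<i> / 2) * iexp (x - L)"
    by (simp only: scaleR_conv_of_real i) simp
qed

lemma integral_scaleR_lincomb:
  fixes p q r :: "'a \<Rightarrow> complex"
  assumes "integrable M (\<lambda>\<omega>. f \<omega> *\<^sub>R p \<omega>)" "integrable M (\<lambda>\<omega>. f \<omega> *\<^sub>R q \<omega>)"
    "integrable M (\<lambda>\<omega>. f \<omega> *\<^sub>R r \<omega>)"
  shows "(\<integral>\<omega>. f \<omega> *\<^sub>R (d * p \<omega> + a * q \<omega> + b * r \<omega>) \<partial>M)
      = d * (\<integral>\<omega>. f \<omega> *\<^sub>R p \<omega> \<partial>M) + a * (\<integral>\<omega>. f \<omega> *\<^sub>R q \<omega> \<partial>M) + b * (\<integral>\<omega>. f \<omega> *\<^sub>R r \<omega> \<partial>M)"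
proof -
  have "(\<lambda>\<omega>. f \<omega> *\<^sub>R (d * p \<omega> + a * q \<omega> + b * r \<omega>))
    = (\<lambda>\<omega>. d * (f \<omega> *\<^sub>R p \<omega>) + a * (f \<omega> *\<^sub>R q \<omega>) + b * (f \<omega> *\<^sub>R r \<omega>))"
    by (auto simp: algebra_simps)
  then show ?thesis using assms by (simp del: mult_scaleR_right)
qed

lemma integral_mult_two_plus:
  fixes f h k :: "'a \<Rightarrow> real"
  assumes fin: "finite_measure M"
    and [measurable]: "f \<in> borel_measurable M" "h \<in> borel_measurable M" "k \<in> borel_measurable M"
    and f: "\<And>\<omega>. \<bar>f \<omega>\<bar> \<le> K" and h: "\<And>\<omega>. \<bar>h \<omega>\<bar> \<le> 1" and k: "\<And>\<omega>. \<bar>k \<omega>\<bar> \<le> 1"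
  shows "(\<integral>\<omega>. (f \<omega> * (2 + h \<omega>)) * k \<omega> \<partial>M)
      = 2 * (\<integral>\<omega>. f \<omega> * k \<omega> \<partial>M) + (\<integral>\<omega>. (f \<omega> * k \<omega>) * h \<omega> \<partial>M)"
proof -
  have fk: "\<bar>f \<omega>\<bar> * \<bar>k \<omega>\<bar> \<le> K" for \<omega>
    using mult_mono[OF f[of \<omega>] k[of \<omega>]] f[of \<omega>] by simp
  have fkh: "\<bar>f \<omega>\<bar> * \<bar>k \<omega>\<bar> * \<bar>h \<omega>\<bar> \<le> K" for \<omega>
    using mult_mono[OF fk[of \<omega>] h[of \<omega>]] f[of \<omega>] by simp
  have "integrable M (\<lambda>\<omega>. f \<omega> * k \<omega>)"
    by (rule finite_measure.integrable_const_bound[OF fin, where B = K]) (use fk in \<open>auto simp: abs_mult\<close>)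
  moreover have "integrable M (\<lambda>\<omega>. (f \<omega> * k \<omega>) * h \<omega>)"
    by (rule finite_measure.integrable_const_bound[OF fin, where B = K]) (use fkh in \<open>auto simp: abs_mult\<close>)
  moreover have "(\<lambda>\<omega>. (f \<omega> * (2 + h \<omega>)) * k \<omega>) = (\<lambda>\<omega>. 2 * (f \<omega> * k \<omega>) + (f \<omega> * k \<omega>) * h \<omega>)"
    by (auto simp: algebra_simps)
  ultimately show ?thesis by simp
qed

text \<open>The weights \<open>2 + cos\<close> and \<open>2 + sin\<close> are positive, and multiplying by them only mixes
  characteristic functions, so one coordinate at a time can be handled by the one-dimensional
  uniqueness theorem.\<close>

lemma weighted_Levy_uniqueness_finite:
  fixes X :: "'i \<Rightarrow> 'a \<Rightarrow> real" and Y :: "'i \<Rightarrow> 'b \<Rightarrow> real"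
  assumes fin: "finite_measure M" "finite_measure N" and "finite J"
    and "f \<in> borel_measurable M" "g \<in> borel_measurable N"
    and "\<And>j. j \<in> J \<Longrightarrow> X j \<in> borel_measurable M" "\<And>j. j \<in> J \<Longrightarrow> Y j \<in> borel_measurable N"
    and "\<And>j. j \<in> J \<Longrightarrow> A j \<in> sets borel"
    and "\<And>\<omega>. 0 \<le> f \<omega>" "\<And>\<omega>. f \<omega> \<le> K" and "\<And>\<omega>. 0 \<le> g \<omega>" "\<And>\<omega>. g \<omega> \<le> L"
    and "\<And>c. (\<integral>\<omega>. f \<omega> *\<^sub>R iexp (\<Sum>j\<in>J. c j * X j \<omega>) \<partial>M) = (\<integral>\<omega>. g \<omega> *\<^sub>R iexp (\<Sum>j\<in>J. c j * Y j \<omega>) \<partial>N)"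
  shows "(\<integral>\<omega>. f \<omega> * (\<Prod>j\<in>J. indicator (A j) (X j \<omega>)) \<partial>M) = (\<integral>\<omega>. g \<omega> * (\<Prod>j\<in>J. indicator (A j) (Y j \<omega>)) \<partial>N)"
  using assms(3-)
proof (induction J arbitrary: f g rule: finite_induct)
  case empty
  then have "complex_of_real (\<integral>\<omega>. f \<omega> \<partial>M) = complex_of_real (\<integral>\<omega>. g \<omega> \<partial>N)"
    by (simp add: scaleR_conv_of_real)
  then show ?case by (simp only: of_real_eq_iff prod.empty mult_1_right)
next
  case (insert k J)
  note [measurable] = insert.prems(1-4) insert.prems(5)[of k]
  have [measurable]: "X k \<in> borel_measurable M" "Y k \<in> borel_measurable N" "A k \<in> sets borel"
    "\<And>j. j \<in> J \<Longrightarrow> X j \<in> borel_measurable M" "\<And>j. j \<in> J \<Longrightarrow> Y j \<in> borel_measurable N"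
    using insert.prems by auto
  note f = insert.prems(6,7) and g = insert.prems(8,9)
  have absf: "\<bar>f \<omega>\<bar> \<le> K" for \<omega> using f[of \<omega>] by simp
  have absg: "\<bar>g \<omega>\<bar> \<le> L" for \<omega> using g[of \<omega>] by simp
  have K: "0 \<le> K" using f order_trans by blast
  have L: "0 \<le> L" using g order_trans by blast
  let ?X = "\<lambda>c \<omega>. \<Sum>j\<in>J. c j * X j \<omega>" and ?Y = "\<lambda>c \<omega>. \<Sum>j\<in>J. c j * Y j \<omega>"
  have eq: "(\<integral>\<omega>. f \<omega> *\<^sub>R iexp (s * X k \<omega> + ?X c \<omega>) \<partial>M) = (\<integral>\<omega>. g \<omega> *\<^sub>R iexp (s * Y k \<omega> + ?Y c \<omega>) \<partial>N)"
    for s c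
  proof -
    have "(\<Sum>j\<in>J. (c(k := s)) j * z j) = (\<Sum>j\<in>J. c j * z j)" for z
      using insert.hyps by (intro sum.cong) auto
    then show ?thesis using insert.prems(10)[of "c(k := s)"] insert.hyps by simp
  qed
  have eqm: "(\<integral>\<omega>. f \<omega> *\<^sub>R iexp (s * X k \<omega> - ?X c \<omega>) \<partial>M) = (\<integral>\<omega>. g \<omega> *\<^sub>R iexp (s * Y k \<omega> - ?Y c \<omega>) \<partial>N)"
    for s c
    using eq[of s "\<lambda>j. - c j"] by (simp add: sum_negf)
  have eq0: "(\<integral>\<omega>. f \<omega> *\<^sub>R iexp (s * X k \<omega>) \<partial>M) = (\<integral>\<omega>. g \<omega> *\<^sub>R iexp (s * Y k \<omega>) \<partial>N)" for s
    using eq[of s "\<lambda>_. 0"] by simp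
  have intf: "integrable M (\<lambda>\<omega>. f \<omega> *\<^sub>R iexp (h \<omega>))" if "h \<in> borel_measurable M" for h
    by (rule integrable_bounded_iexp[OF fin(1) _ that absf]) simp
  have intg: "integrable N (\<lambda>\<omega>. g \<omega> *\<^sub>R iexp (h \<omega>))" if "h \<in> borel_measurable N" for h
    by (rule integrable_bounded_iexp[OF fin(2) _ that absg]) simp
  have mX: "(\<lambda>\<omega>. s * X k \<omega>) \<in> borel_measurable M" "(\<lambda>\<omega>. s * X k \<omega> + ?X c \<omega>) \<in> borel_measurable M"
    "(\<lambda>\<omega>. s * X k \<omega> - ?X c \<omega>) \<in> borel_measurable M" for s c by measurable
  have mY: "(\<lambda>\<omega>. s * Y k \<omega>) \<in> borel_measurable N" "(\<lambda>\<omega>. s * Y k \<omega> + ?Y c \<omega>) \<in> borel_measurable N"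
    "(\<lambda>\<omega>. s * Y k \<omega> - ?Y c \<omega>) \<in> borel_measurable N" for s c by measurable
  have cosb: "0 \<le> 2 + cos x" "2 + cos x \<le> 3" "0 \<le> 2 + sin x" "2 + sin x \<le> 3" for x :: real
    using cos_ge_minus_one[of x] cos_le_one[of x] sin_ge_minus_one[of x] sin_le_one[of x] by linarith+
  have step0: "(\<integral>\<omega>. f \<omega> * indicator (A k) (X k \<omega>) \<partial>M) = (\<integral>\<omega>. g \<omega> * indicator (A k) (Y k \<omega>) \<partial>N)"
    by (rule weighted_Levy_uniqueness[OF fin _ _ _ _ _ f g eq0]) simp_all
  have stepc: "(\<integral>\<omega>. (f \<omega> * (2 + cos (?X c \<omega>))) * indicator (A k) (X k \<omega>) \<partial>M)
      = (\<integral>\<omega>. (g \<omega> * (2 + cos (?Y c \<omega>))) * indicator (A k) (Y k \<omega>) \<partial>N)" for c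
  proof (rule weighted_Levy_uniqueness[OF fin, where K = "K * 3" and L = "L * 3"])
    fix s
    show "(\<integral>\<omega>. (f \<omega> * (2 + cos (?X c \<omega>))) *\<^sub>R iexp (s * X k \<omega>) \<partial>M)
      = (\<integral>\<omega>. (g \<omega> * (2 + cos (?Y c \<omega>))) *\<^sub>R iexp (s * Y k \<omega>) \<partial>N)"
      unfolding scaleR_scaleR[symmetric] iexp_cos_sin_product
      by (subst (1 2) integral_scaleR_lincomb) (simp_all only: eq eqm eq0 intf intg mX mY)
  qed (use f g cosb K L in \<open>auto intro!: mult_nonneg_nonneg mult_mono\<close>)
  have steps: "(\<integral>\<omega>. (f \<omega> * (2 + sin (?X c \<omega>))) * indicator (A k) (X k \<omega>) \<partial>M)
      = (\<integral>\<omega>. (g \<omega> * (2 + sin (?Y c \<omega>))) * indicator (A k) (Y k \<omega>) \<partial>N)" for c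
  proof (rule weighted_Levy_uniqueness[OF fin, where K = "K * 3" and L = "L * 3"])
    fix s
    show "(\<integral>\<omega>. (f \<omega> * (2 + sin (?X c \<omega>))) *\<^sub>R iexp (s * X k \<omega>) \<partial>M)
      = (\<integral>\<omega>. (g \<omega> * (2 + sin (?Y c \<omega>))) *\<^sub>R iexp (s * Y k \<omega>) \<partial>N)"
      unfolding scaleR_scaleR[symmetric] iexp_cos_sin_product
      by (subst (1 2) integral_scaleR_lincomb) (simp_all only: eq eqm eq0 intf intg mX mY)
  qed (use f g cosb K L in \<open>auto intro!: mult_nonneg_nonneg mult_mono\<close>)
  let ?f = "\<lambda>\<omega>. f \<omega> * indicator (A k) (X k \<omega>)" and ?g = "\<lambda>\<omega>. g \<omega> * indicator (A k) (Y k \<omega>)"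
  have f': "0 \<le> ?f \<omega>" "?f \<omega> \<le> K" for \<omega> using f[of \<omega>] K by (auto simp: indicator_def)
  have g': "0 \<le> ?g \<omega>" "?g \<omega> \<le> L" for \<omega> using g[of \<omega>] L by (auto simp: indicator_def)
  have split: "(\<integral>\<omega>. (f \<omega> * (2 + h \<omega>)) * indicator (A k) (X k \<omega>) \<partial>M)
      = 2 * (\<integral>\<omega>. ?f \<omega> \<partial>M) + (\<integral>\<omega>. ?f \<omega> * h \<omega> \<partial>M)"
    if "h \<in> borel_measurable M" "\<And>\<omega>. \<bar>h \<omega>\<bar> \<le> 1" for h
    by (rule integral_mult_two_plus[OF fin(1) _ _ _ absf]) (use that in \<open>auto simp: indicator_def\<close>)
  have split': "(\<integral>\<omega>. (g \<omega> * (2 + h \<omega>)) * indicator (A k) (Y k \<omega>) \<partial>N)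
      = 2 * (\<integral>\<omega>. ?g \<omega> \<partial>N) + (\<integral>\<omega>. ?g \<omega> * h \<omega> \<partial>N)"
    if "h \<in> borel_measurable N" "\<And>\<omega>. \<bar>h \<omega>\<bar> \<le> 1" for h
    by (rule integral_mult_two_plus[OF fin(2) _ _ _ absg]) (use that in \<open>auto simp: indicator_def\<close>)
  have "(\<integral>\<omega>. ?f \<omega> * (\<Prod>j\<in>J. indicator (A j) (X j \<omega>)) \<partial>M) = (\<integral>\<omega>. ?g \<omega> * (\<Prod>j\<in>J. indicator (A j) (Y j \<omega>)) \<partial>N)"
  proof (rule insert.IH)
    fix c
    have cc: "(\<integral>\<omega>. ?f \<omega> * cos (?X c \<omega>) \<partial>M) = (\<integral>\<omega>. ?g \<omega> * cos (?Y c \<omega>) \<partial>N)"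
      using stepc[of c] step0 split[of "\<lambda>\<omega>. cos (?X c \<omega>)"] split'[of "\<lambda>\<omega>. cos (?Y c \<omega>)"] by simp
    have ss: "(\<integral>\<omega>. ?f \<omega> * sin (?X c \<omega>) \<partial>M) = (\<integral>\<omega>. ?g \<omega> * sin (?Y c \<omega>) \<partial>N)"
      using steps[of c] step0 split[of "\<lambda>\<omega>. sin (?X c \<omega>)"] split'[of "\<lambda>\<omega>. sin (?Y c \<omega>)"] by simp
    have iM: "integrable M (\<lambda>\<omega>. ?f \<omega> *\<^sub>R iexp (?X c \<omega>))"
      by (rule integrable_bounded_iexp[OF fin(1), where K = K]) (use f' in auto)
    have iN: "integrable N (\<lambda>\<omega>. ?g \<omega> *\<^sub>R iexp (?Y c \<omega>))"
      by (rule integrable_bounded_iexp[OF fin(2), where K = L]) (use g' in auto)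
    show "(\<integral>\<omega>. ?f \<omega> *\<^sub>R iexp (?X c \<omega>) \<partial>M) = (\<integral>\<omega>. ?g \<omega> *\<^sub>R iexp (?Y c \<omega>) \<partial>N)"
      unfolding complex_eq_iff integral_Re[OF iM, symmetric] integral_Re[OF iN, symmetric]
        integral_Im[OF iM, symmetric] integral_Im[OF iN, symmetric]
      using cc ss by (simp add: Re_exp Im_exp)
  qed (use insert.prems f' g' in auto)
  then show ?case using insert.hyps by (simp add: mult.assoc)
qed

lemma distr_PiM_eq_if_char_eq:
  fixes X :: "'i \<Rightarrow> 'a \<Rightarrow> real" and Y :: "'i \<Rightarrow> 'b \<Rightarrow> real"
  assumes "prob_space M" "prob_space N" and J: "finite J"
    and X: "\<And>j. X j \<in> borel_measurable M" and Y: "\<And>j. Y j \<in> borel_measurable N"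
    and eq: "\<And>c. (\<integral>\<omega>. iexp (\<Sum>j\<in>J. c j * X j \<omega>) \<partial>M) = (\<integral>\<omega>. iexp (\<Sum>j\<in>J. c j * Y j \<omega>) \<partial>N)"
  shows "distr M (PiM J (\<lambda>_. borel)) (\<lambda>\<omega>. \<lambda>j\<in>J. X j \<omega>) = distr N (PiM J (\<lambda>_. borel)) (\<lambda>\<omega>. \<lambda>j\<in>J. Y j \<omega>)"
proof -
  interpret M: prob_space M by fact
  interpret N: prob_space N by fact
  note [measurable] = X Y
  show ?thesis
  proof (rule measure_eqI_PiM_finite[OF J, where A = "\<lambda>_. PiE J (\<lambda>_. UNIV)"])
    fix A :: "'i \<Rightarrow> real set"
    assume A: "\<And>j. j \<in> J \<Longrightarrow> A j \<in> sets borel"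
    have "(\<integral>\<omega>. (1::real) * (\<Prod>j\<in>J. indicator (A j) (X j \<omega>)) \<partial>M) = (\<integral>\<omega>. 1 * (\<Prod>j\<in>J. indicator (A j) (Y j \<omega>)) \<partial>N)"
      by (rule weighted_Levy_uniqueness_finite[OF M.finite_measure_axioms N.finite_measure_axioms J,
            where K = 1 and L = 1])
        (use A eq in \<open>simp_all only: scaleR_one X Y, auto\<close>)
    then have *: "(\<integral>\<omega>. (\<Prod>j\<in>J. indicator (A j) (X j \<omega>)) \<partial>M) = (\<integral>\<omega>. (\<Prod>j\<in>J. indicator (A j) (Y j \<omega>) :: real) \<partial>N)"
      by (simp only: mult_1)
    have pM: "(\<Prod>j\<in>J. indicator (A j) (z j)) = (indicator (PiE J A) (\<lambda>j\<in>J. z j) :: real)" for z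
      using J by (auto simp: indicator_def PiE_iff prod_zero_iff)
    have box: "PiE J A \<inter> (J \<rightarrow>\<^sub>E UNIV) = PiE J A" by (auto simp: PiE_iff)
    have [measurable]: "PiE J A \<in> sets (PiM J (\<lambda>_. borel))"
      using J A by (intro sets_PiM_I_finite) auto
    have "measure (distr M (PiM J (\<lambda>_. borel)) (\<lambda>\<omega>. \<lambda>j\<in>J. X j \<omega>)) (PiE J A)
        = measure (distr N (PiM J (\<lambda>_. borel)) (\<lambda>\<omega>. \<lambda>j\<in>J. Y j \<omega>)) (PiE J A)"
    proof -
      have "measure (distr M (PiM J (\<lambda>_. borel)) (\<lambda>\<omega>. \<lambda>j\<in>J. X j \<omega>)) (PiE J A)
        = (\<integral>x. indicator (PiE J A) x \<partial>distr M (PiM J (\<lambda>_. borel)) (\<lambda>\<omega>. \<lambda>j\<in>J. X j \<omega>))"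
        by (simp add: space_PiM box)
      also have "\<dots> = (\<integral>\<omega>. (\<Prod>j\<in>J. indicator (A j) (X j \<omega>)) \<partial>M)"
        unfolding pM by (rule integral_distr) measurable
      also note *
      also have "(\<integral>\<omega>. (\<Prod>j\<in>J. indicator (A j) (Y j \<omega>)) \<partial>N) =
         (\<integral>x. (indicator (PiE J A) x :: real) \<partial>distr N (PiM J (\<lambda>_. borel)) (\<lambda>\<omega>. \<lambda>j\<in>J. Y j \<omega>))"
        unfolding pM by (rule integral_distr[symmetric]) measurable
      also have "\<dots> = measure (distr N (PiM J (\<lambda>_. borel)) (\<lambda>\<omega>. \<lambda>j\<in>J. Y j \<omega>)) (PiE J A)"
        by (simp add: space_PiM box)
      finally show ?thesis .
    qed
    moreover have "finite_measure (distr M (PiM J (\<lambda>_. borel)) (\<lambda>\<omega>. \<lambda>j\<in>J. X j \<omega>))"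
      "finite_measure (distr N (PiM J (\<lambda>_. borel)) (\<lambda>\<omega>. \<lambda>j\<in>J. Y j \<omega>))"
      by (auto intro!: M.finite_measure_distr N.finite_measure_distr)
    ultimately show "emeasure (distr M (PiM J (\<lambda>_. borel)) (\<lambda>\<omega>. \<lambda>j\<in>J. X j \<omega>)) (PiE J A)
        = emeasure (distr N (PiM J (\<lambda>_. borel)) (\<lambda>\<omega>. \<lambda>j\<in>J. Y j \<omega>)) (PiE J A)"
      by (simp add: finite_measure.emeasure_eq_measure)
  next
    show "range (\<lambda>_. PiE J (\<lambda>_. UNIV)) \<subseteq> prod_algebra J (\<lambda>_. borel :: real measure)"
      using J by (auto intro!: prod_algebraI_finite)
    show "emeasure (distr M (PiM J (\<lambda>_. borel)) (\<lambda>\<omega>. \<lambda>j\<in>J. X j \<omega>)) (PiE J (\<lambda>_. UNIV)) \<noteq> \<infinity>"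
      by (auto intro!: finite_measure.emeasure_finite M.finite_measure_distr)
  qed (auto simp: space_PiM)
qed

lemma borel_measurable_vec_nth [measurable]:
  "(\<lambda>x::real^'n. x $ i) \<in> borel_measurable borel"
  by (intro borel_measurable_continuous_onI continuous_intros)

lemma stoch_equiv_iff_char:
  fixes Y :: "nat \<Rightarrow> 'a \<Rightarrow> real^'p" and Z :: "nat \<Rightarrow> 'b \<Rightarrow> real^'p"
  assumes M: "prob_space M" and N: "prob_space N"
    and Y[measurable]: "\<And>t. Y t \<in> borel_measurable M" and Z[measurable]: "\<And>t. Z t \<in> borel_measurable N"
  shows "stoch_equiv M Y N Z \<longleftrightarrow>
    (\<forall>n c. (\<integral>\<omega>. iexp (\<Sum>t<n. c t \<bullet> Y t \<omega>) \<partial>M) = (\<integral>\<omega>. iexp (\<Sum>t<n. c t \<bullet> Z t \<omega>) \<partial>N))"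
proof
  assume eq: "stoch_equiv M Y N Z"
  show "\<forall>n c. (\<integral>\<omega>. iexp (\<Sum>t<n. c t \<bullet> Y t \<omega>) \<partial>M) = (\<integral>\<omega>. iexp (\<Sum>t<n. c t \<bullet> Z t \<omega>) \<partial>N)"
  proof (intro allI)
    fix n :: nat and c :: "nat \<Rightarrow> real^'p"
    let ?P = "PiM {..<n} (\<lambda>_. borel :: (real^'p) measure)" and ?h = "\<lambda>x. iexp (\<Sum>t<n. c t \<bullet> x t)"
    have h[measurable]: "?h \<in> borel_measurable ?P" by measurable
    have "(\<integral>\<omega>. iexp (\<Sum>t<n. c t \<bullet> Y t \<omega>) \<partial>M) = (\<integral>\<omega>. ?h (\<lambda>t\<in>{..<n}. Y t \<omega>) \<partial>M)"
      by simp
    also have "\<dots> = integral\<^sup>L (distr M ?P (\<lambda>\<omega>. \<lambda>t\<in>{..<n}. Y t \<omega>)) ?h"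
      by (rule integral_distr[symmetric]) measurable
    also have "\<dots> = integral\<^sup>L (distr N ?P (\<lambda>\<omega>. \<lambda>t\<in>{..<n}. Z t \<omega>)) ?h"
      using eq by (simp add: stoch_equiv_def)
    also have "\<dots> = (\<integral>\<omega>. ?h (\<lambda>t\<in>{..<n}. Z t \<omega>) \<partial>N)"
      by (rule integral_distr) measurable
    also have "\<dots> = (\<integral>\<omega>. iexp (\<Sum>t<n. c t \<bullet> Z t \<omega>) \<partial>N)" by simp
    finally show "(\<integral>\<omega>. iexp (\<Sum>t<n. c t \<bullet> Y t \<omega>) \<partial>M) = (\<integral>\<omega>. iexp (\<Sum>t<n. c t \<bullet> Z t \<omega>) \<partial>N)" .
  qed
next
  assume eq: "\<forall>n c. (\<integral>\<omega>. iexp (\<Sum>t<n. c t \<bullet> Y t \<omega>) \<partial>M) = (\<integral>\<omega>. iexp (\<Sum>t<n. c t \<bullet> Z t \<omega>) \<partial>N)"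
  show "stoch_equiv M Y N Z"
    unfolding stoch_equiv_def
  proof (intro allI impI)
    fix T :: "nat set" assume T: "finite T"
    then obtain n where n: "T \<subseteq> {..<n}" using finite_nat_iff_bounded by auto
    let ?J = "T \<times> (UNIV :: 'p set)"
    let ?P = "PiM ?J (\<lambda>_. borel :: real measure)" and ?Q = "PiM T (\<lambda>_. borel :: (real^'p) measure)"
    have lin: "(\<Sum>j\<in>?J. c j * (V (fst j) \<omega> $ snd j)) = (\<Sum>t<n. (if t \<in> T then \<chi> i. c (t, i) else 0) \<bullet> V t \<omega>)"
      for c and V :: "nat \<Rightarrow> 'z \<Rightarrow> real^'p" and \<omega>
    proof -
      have "(\<Sum>j\<in>?J. c j * (V (fst j) \<omega> $ snd j)) = (\<Sum>t\<in>T. \<Sum>i\<in>UNIV. c (t, i) * V t \<omega> $ i)"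
        by (simp add: sum.cartesian_product split_def)
      also have "\<dots> = (\<Sum>t\<in>T. (if t \<in> T then \<chi> i. c (t, i) else 0) \<bullet> V t \<omega>)"
        by (intro sum.cong) (auto simp: inner_vec_def)
      also have "\<dots> = (\<Sum>t<n. (if t \<in> T then \<chi> i. c (t, i) else 0) \<bullet> V t \<omega>)"
        using n by (intro sum.mono_neutral_left) auto
      finally show ?thesis .
    qed
    have PQ: "distr M ?P (\<lambda>\<omega>. \<lambda>j\<in>?J. Y (fst j) \<omega> $ snd j) = distr N ?P (\<lambda>\<omega>. \<lambda>j\<in>?J. Z (fst j) \<omega> $ snd j)"
    proof (rule distr_PiM_eq_if_char_eq[OF M N])
      fix c :: "nat \<times> 'p \<Rightarrow> real"
      show "(\<integral>\<omega>. iexp (\<Sum>j\<in>?J. c j * (Y (fst j) \<omega> $ snd j)) \<partial>M) = (\<integral>\<omega>. iexp (\<Sum>j\<in>?J. c j * (Z (fst j) \<omega> $ snd j)) \<partial>N)"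
        unfolding lin by (rule eq[rule_format])
    qed (use T in auto)
    let ?\<phi> = "\<lambda>z. \<lambda>t\<in>T. (\<chi> i. z (t, i)) :: real^'p"
    have [measurable]: "?\<phi> \<in> measurable ?P ?Q"
    proof (rule measurable_restrict)
      fix t assume "t \<in> T"
      then show "(\<lambda>z. (\<chi> i. z (t, i)) :: real^'p) \<in> borel_measurable ?P"
        by (subst borel_measurable_euclidean_space) (auto simp: Basis_vec_def inner_axis)
    qed
    have "distr M ?Q (\<lambda>\<omega>. \<lambda>t\<in>T. Y t \<omega>) = distr (distr M ?P (\<lambda>\<omega>. \<lambda>j\<in>?J. Y (fst j) \<omega> $ snd j)) ?Q ?\<phi>"
      by (subst distr_distr, measurable) (auto simp: comp_def vec_eq_iff restrict_def intro!: distr_cong)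
    also have "\<dots> = distr N ?Q (\<lambda>\<omega>. \<lambda>t\<in>T. Z t \<omega>)"
      unfolding PQ by (subst distr_distr, measurable) (auto simp: comp_def vec_eq_iff restrict_def intro!: distr_cong)
    finally show "distr M ?Q (\<lambda>\<omega>. \<lambda>t\<in>T. Y t \<omega>) = distr N ?Q (\<lambda>\<omega>. \<lambda>t\<in>T. Z t \<omega>)" .
  qed
qed

subsection \<open>Gaussian noise\<close>

lemma char_gaussian_vec:
  assumes X: "gaussian_vec M X m S"
  shows "(\<integral>\<omega>. iexp (a \<bullet> X \<omega>) \<partial>M) = exp (\<i> * of_real (a \<bullet> m) - of_real (a \<bullet> (S *v a)) / 2)"
proof -
  have [measurable]: "X \<in> borel_measurable M" using X by (simp add: gaussian_vec_def)
  have d: "distr M borel (\<lambda>\<omega>. a \<bullet> X \<omega>) = (if a \<bullet> (S *v a) = 0 then return borel (a \<bullet> m)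
           else density lborel (\<lambda>x. ennreal (normal_density (a \<bullet> m) (sqrt (a \<bullet> (S *v a))) x)))"
    and S: "0 \<le> a \<bullet> (S *v a)"
    using X unfolding gaussian_vec_def by blast+
  have I: "(\<integral>\<omega>. iexp (a \<bullet> X \<omega>) \<partial>M) = (\<integral>x. iexp x \<partial>distr M borel (\<lambda>\<omega>. a \<bullet> X \<omega>))"
    by (subst integral_distr) auto
  show ?thesis
  proof (cases "a \<bullet> (S *v a) = 0")
    case True
    then show ?thesis unfolding I d by (simp add: integral_return)
  next
    case False
    define \<sigma> where "\<sigma> = sqrt (a \<bullet> (S *v a))"
    have \<sigma>: "0 < \<sigma>" "\<sigma>\<^sup>2 = a \<bullet> (S *v a)" using False S by (auto simp: \<sigma>_def)
    let ?m = "a \<bullet> m"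
    have dens: "normal_density ?m \<sigma> (?m + \<sigma> * x) = std_normal_density x / \<sigma>" for x
      using \<sigma>(1) by (simp add: normal_density_def real_sqrt_mult field_simps)
    have "(\<integral>x. iexp x \<partial>density lborel (\<lambda>x. ennreal (normal_density ?m \<sigma> x)))
       = (\<integral>x. normal_density ?m \<sigma> x *\<^sub>R iexp x \<partial>lborel)"
      by (rule integral_density) (use \<sigma> in \<open>auto simp: normal_density_nonneg\<close>)
    also have "\<dots> = \<bar>\<sigma>\<bar> *\<^sub>R (\<integral>x. normal_density ?m \<sigma> (?m + \<sigma> * x) *\<^sub>R iexp (?m + \<sigma> * x) \<partial>lborel)"
      by (rule lborel_integral_real_affine) (use \<sigma> in auto)
    also have "\<dots> = (\<integral>x. iexp ?m * (std_normal_density x *\<^sub>R iexp (\<sigma> * x)) \<partial>lborel)"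
      unfolding dens using \<sigma>(1)
      by (subst integral_scaleR_right[symmetric])
        (auto intro!: Bochner_Integration.integral_cong simp: exp_add algebra_simps)
    also have "\<dots> = iexp ?m * (\<integral>x. std_normal_density x *\<^sub>R iexp (\<sigma> * x) \<partial>lborel)"
      by (rule integral_mult_right_zero)
    also have "(\<integral>x. std_normal_density x *\<^sub>R iexp (\<sigma> * x) \<partial>lborel) = char std_normal_distribution \<sigma>"
      unfolding char_def by (rule integral_density[symmetric]) (auto simp: normal_density_nonneg)
    also have "\<dots> = of_real (exp (- (\<sigma>\<^sup>2) / 2))"
      by (simp add: char_std_normal_distribution)
    also have "iexp ?m * of_real (exp (- (\<sigma>\<^sup>2) / 2)) = exp (\<i> * of_real ?m - of_real (\<sigma>\<^sup>2) / 2)"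
      by (simp add: exp_of_real[symmetric] exp_add[symmetric] del: of_real_power)
    finally show ?thesis unfolding I d using False by (simp add: \<sigma>_def[symmetric] \<sigma>(2))
  qed
qed

lemma char_sum_indep_gaussian:
  assumes "prob_space M" and ind: "prob_space.indep_vars M (\<lambda>_. borel) w UNIV"
    and w: "\<And>t::nat. gaussian_vec M (w t) m S"
  shows "(\<integral>\<omega>. iexp (\<Sum>t<n. a t \<bullet> w t \<omega>) \<partial>M)
    = exp (\<i> * of_real (\<Sum>t<n. a t \<bullet> m) - of_real (\<Sum>t<n. a t \<bullet> (S *v a t)) / 2)"
proof -
  interpret prob_space M by fact
  have [measurable]: "w t \<in> borel_measurable M" for t using w by (simp add: gaussian_vec_def)
  have "(\<integral>\<omega>. iexp (\<Sum>t<n. a t \<bullet> w t \<omega>) \<partial>M) = (\<integral>\<omega>. (\<Prod>t<n. iexp (a t \<bullet> w t \<omega>)) \<partial>M)"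
    by (simp add: sum_distrib_left exp_sum)
  also have "\<dots> = (\<Prod>t<n. \<integral>\<omega>. iexp (a t \<bullet> w t \<omega>) \<partial>M)"
  proof (rule indep_vars_lebesgue_integral)
    have "indep_vars (\<lambda>_. borel) w {..<n}" by (rule indep_vars_subset[OF ind]) auto
    then show "indep_vars (\<lambda>_. borel) (\<lambda>t \<omega>. iexp (a t \<bullet> w t \<omega>)) {..<n}"
      by (rule indep_vars_compose2) auto
    show "integrable M (\<lambda>\<omega>. iexp (a t \<bullet> w t \<omega>))" for t
      by (rule integrable_iexp) auto
  qed simp
  also have "\<dots> = exp (\<i> * of_real (\<Sum>t<n. a t \<bullet> m) - of_real (\<Sum>t<n. a t \<bullet> (S *v a t)) / 2)"
    unfolding char_gaussian_vec[OF w]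
    by (simp add: exp_sum[symmetric] sum_subtractf sum_distrib_left sum_divide_distrib)
  finally show ?thesis .
qed

lemma char_noise:
  assumes nm: "noise_model M w \<nu> \<mu> \<Psi>"
  shows "(\<integral>\<omega>. iexp ((\<Sum>t<n. a t \<bullet> w t \<omega>) + (\<Sum>t<n. c t \<bullet> \<nu> t \<omega>)) \<partial>M)
    = exp (\<i> * of_real (\<Sum>t<n. a t \<bullet> \<mu>) - of_real ((\<Sum>t<n. a t \<bullet> a t) + (\<Sum>t<n. c t \<bullet> (\<Psi> *v c t))) / 2)"
proof -
  interpret prob_space M using nm by (simp add: noise_model_def)
  have w: "\<And>t. gaussian_vec M (w t) \<mu> (mat 1)" and \<nu>: "\<And>t. gaussian_vec M (\<nu> t) 0 \<Psi>"
    and iw: "indep_vars (\<lambda>_. borel) w UNIV" and i\<nu>: "indep_vars (\<lambda>_. borel) \<nu> UNIV"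
    and ind: "indep_set
       (sets (vimage_algebra (space M) (\<lambda>\<omega> t. w t \<omega>) (PiM UNIV (\<lambda>_. borel))))
       (sets (vimage_algebra (space M) (\<lambda>\<omega> t. \<nu> t \<omega>) (PiM UNIV (\<lambda>_. borel))))"
    using nm by (auto simp: noise_model_def)
  have [measurable]: "w t \<in> borel_measurable M" "\<nu> t \<in> borel_measurable M" for t
    using w \<nu> by (auto simp: gaussian_vec_def)
  have sub: "sigma_sets (space M) {(\<lambda>\<omega>. iexp (\<Sum>t<n. b t \<bullet> v t \<omega>)) -` A \<inter> space M |A. A \<in> sets borel}
      \<subseteq> sets (vimage_algebra (space M) (\<lambda>\<omega> t. v t \<omega>) (PiM UNIV (\<lambda>_. borel)))"
    for b :: "nat \<Rightarrow> real^'z" and v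
  proof -
    let ?V = "vimage_algebra (space M) (\<lambda>\<omega> t. v t \<omega>) (PiM UNIV (\<lambda>_. borel :: (real^'z) measure))"
    have "(\<lambda>\<omega> t. v t \<omega>) \<in> measurable ?V (PiM UNIV (\<lambda>_. borel))"
      by (rule measurable_vimage_algebra1) (auto simp: space_PiM)
    then have m: "(\<lambda>\<omega>. iexp (\<Sum>t<n. b t \<bullet> v t \<omega>)) \<in> borel_measurable ?V"
      by (rule measurable_compose[where g = "\<lambda>x. iexp (\<Sum>t<n. b t \<bullet> x t)"]) measurable
    have "{(\<lambda>\<omega>. iexp (\<Sum>t<n. b t \<bullet> v t \<omega>)) -` A \<inter> space M |A. A \<in> sets borel} \<subseteq> sets ?V"
      using measurable_sets[OF m] unfolding space_vimage_algebra by blast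
    then show ?thesis
      by (rule sets.sigma_sets_subset[of _ ?V, unfolded space_vimage_algebra])
  qed
  have *: "indep_var borel (\<lambda>\<omega>. iexp (\<Sum>t<n. a t \<bullet> w t \<omega>)) borel (\<lambda>\<omega>. iexp (\<Sum>t<n. c t \<bullet> \<nu> t \<omega>))"
    unfolding indep_var_eq
  proof (intro conjI)
    show "indep_set (sigma_sets (space M) {(\<lambda>\<omega>. iexp (\<Sum>t<n. a t \<bullet> w t \<omega>)) -` A \<inter> space M |A. A \<in> sets borel})
      (sigma_sets (space M) {(\<lambda>\<omega>. iexp (\<Sum>t<n. c t \<bullet> \<nu> t \<omega>)) -` A \<inter> space M |A. A \<in> sets borel})"
      using ind unfolding indep_set_def
      by (rule indep_sets_mono_sets) (use sub[of a w] sub[of c \<nu>] in \<open>auto split: bool.split\<close>)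
  qed measurable
  have "(\<integral>\<omega>. iexp ((\<Sum>t<n. a t \<bullet> w t \<omega>) + (\<Sum>t<n. c t \<bullet> \<nu> t \<omega>)) \<partial>M)
     = (\<integral>\<omega>. iexp (\<Sum>t<n. a t \<bullet> w t \<omega>) * iexp (\<Sum>t<n. c t \<bullet> \<nu> t \<omega>) \<partial>M)"
    by (simp only: of_real_add distrib_left exp_add)
  also have "\<dots> = (\<integral>\<omega>. iexp (\<Sum>t<n. a t \<bullet> w t \<omega>) \<partial>M) * (\<integral>\<omega>. iexp (\<Sum>t<n. c t \<bullet> \<nu> t \<omega>) \<partial>M)"
    by (rule indep_var_lebesgue_integral[OF *]) (rule integrable_iexp, measurable)+
  also have "\<dots> = exp (\<i> * of_real (\<Sum>t<n. a t \<bullet> \<mu>) - of_real ((\<Sum>t<n. a t \<bullet> a t) + (\<Sum>t<n. c t \<bullet> (\<Psi> *v c t))) / 2)"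
    unfolding char_sum_indep_gaussian[OF prob_space_axioms iw w] char_sum_indep_gaussian[OF prob_space_axioms i\<nu> \<nu>]
    by (simp add: exp_add[symmetric] add_divide_distrib diff_diff_eq)
  finally show ?thesis .
qed

subsection \<open>Mean and covariance of the output\<close>

definition out_mean :: "real^'n^'n \<Rightarrow> real^'m^'n \<Rightarrow> real^'l^'n \<Rightarrow> real^'n^'p \<Rightarrow> real^'l
    \<Rightarrow> real^'n \<Rightarrow> (nat \<Rightarrow> real^'m) \<Rightarrow> nat \<Rightarrow> real^'p" where
  "out_mean A B G C \<mu> x u t = (C ** mpow A t) *v x + (\<Sum>\<tau><t. (C ** mpow A (t - 1 - \<tau>) ** B) *v u \<tau>)
     + (\<Sum>\<tau><t. (C ** mpow A (t - 1 - \<tau>) ** G) *v \<mu>)"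

definition conv_adj :: "(nat \<Rightarrow> real^'l^'p) \<Rightarrow> nat \<Rightarrow> (nat \<Rightarrow> real^'p) \<Rightarrow> nat \<Rightarrow> real^'l" where
  "conv_adj D n c \<tau> = (\<Sum>t<n. if \<tau> < t then transpose (D (t - 1 - \<tau>)) *v c t else 0)"

definition cov_form :: "(nat \<Rightarrow> real^'l^'p) \<Rightarrow> real^'p^'p \<Rightarrow> nat \<Rightarrow> (nat \<Rightarrow> real^'p) \<Rightarrow> (nat \<Rightarrow> real^'p) \<Rightarrow> real" where
  "cov_form D \<Psi> n c d = (\<Sum>\<tau><n. conv_adj D n c \<tau> \<bullet> conv_adj D n d \<tau>) + (\<Sum>t<n. c t \<bullet> (\<Psi> *v d t))"

lemma inner_transpose_mult:
  fixes P :: "real^'l^'p"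
  shows "(transpose P *v x) \<bullet> y = x \<bullet> (P *v y)"
  by (simp add: dot_lmul_matrix)

lemma matrix_eq_inner:
  fixes P Q :: "real^'n^'m"
  shows "P = Q \<longleftrightarrow> (\<forall>x y. x \<bullet> (P *v y) = x \<bullet> (Q *v y))"
  by (metis matrix_eq vector_eq_ldot)

lemma output_traj_mean:
  "output_traj A B G C w \<nu> x u t \<omega> = out_mean A B G C \<mu> x u t
     + (\<Sum>\<tau><t. (C ** mpow A (t - 1 - \<tau>) ** G) *v (w \<tau> \<omega> - \<mu>)) + \<nu> t \<omega>"
  by (simp add: output_traj_def state_traj_def out_mean_def matrix_vector_right_distrib
      matrix_vector_mult_diff_distrib linear_sum[OF matrix_vector_mul_linear] sum.distrib sum_subtractf
      matrix_vector_mul_assoc matrix_mul_assoc)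

lemma sum_inner_convolution:
  fixes D :: "nat \<Rightarrow> real^'l^'p"
  shows "(\<Sum>t<n. c t \<bullet> (\<Sum>\<tau><t. D (t - 1 - \<tau>) *v z \<tau>)) = (\<Sum>\<tau><n. conv_adj D n c \<tau> \<bullet> z \<tau>)"
proof -
  have "c t \<bullet> (\<Sum>\<tau><t. D (t - 1 - \<tau>) *v z \<tau>)
      = (\<Sum>\<tau><n. (if \<tau> < t then transpose (D (t - 1 - \<tau>)) *v c t else 0) \<bullet> z \<tau>)" if "t < n" for t
  proof -
    have "c t \<bullet> (\<Sum>\<tau><t. D (t - 1 - \<tau>) *v z \<tau>) = (\<Sum>\<tau><t. (if \<tau> < t then transpose (D (t - 1 - \<tau>)) *v c t else 0) \<bullet> z \<tau>)"
      by (simp add: inner_sum_right inner_transpose_mult del: transpose_matrix_vector)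
    also have "\<dots> = (\<Sum>\<tau><n. (if \<tau> < t then transpose (D (t - 1 - \<tau>)) *v c t else 0) \<bullet> z \<tau>)"
      using that by (intro sum.mono_neutral_left) auto
    finally show ?thesis .
  qed
  then have "(\<Sum>t<n. c t \<bullet> (\<Sum>\<tau><t. D (t - 1 - \<tau>) *v z \<tau>))
      = (\<Sum>t<n. \<Sum>\<tau><n. (if \<tau> < t then transpose (D (t - 1 - \<tau>)) *v c t else 0) \<bullet> z \<tau>)"
    by (intro sum.cong) auto
  also have "\<dots> = (\<Sum>\<tau><n. conv_adj D n c \<tau> \<bullet> z \<tau>)"
    unfolding conv_adj_def inner_sum_left by (rule sum.swap)
  finally show ?thesis .
qed

lemma borel_measurable_matrix_vector_mult:
  fixes P :: "real^'n^'m"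
  assumes "f \<in> borel_measurable M"
  shows "(\<lambda>\<omega>. P *v f \<omega>) \<in> borel_measurable M"
  by (rule measurable_compose[OF assms])
    (intro borel_measurable_continuous_onI matrix_vector_mult_linear_continuous_on)

lemma output_traj_measurable:
  assumes "noise_model M w \<nu> \<mu> \<Psi>"
  shows "output_traj A B G C w \<nu> x u t \<in> borel_measurable M"
proof -
  have w: "w s \<in> borel_measurable M" and \<nu>: "\<nu> s \<in> borel_measurable M" for s
    using assms by (auto simp: noise_model_def gaussian_vec_def)
  have "(\<lambda>\<omega>. out_mean A B G C 0 x u t
     + (\<Sum>\<tau><t. (C ** mpow A (t - 1 - \<tau>) ** G) *v (w \<tau> \<omega> - 0)) + \<nu> t \<omega>) \<in> borel_measurable M"
    by (intro borel_measurable_add borel_measurable_sum borel_measurable_matrix_vector_mult borel_measurable_diff w \<nu> borel_measurable_const)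
  then show ?thesis
    by (simp add: output_traj_mean[of A B G C w \<nu> x u t _ 0, abs_def])
qed

lemma char_output_traj:
  assumes nm: "noise_model M w \<nu> \<mu> \<Psi>"
  shows "(\<integral>\<omega>. iexp (\<Sum>t<n. c t \<bullet> output_traj A B G C w \<nu> x u t \<omega>) \<partial>M)
    = exp (\<i> * of_real (\<Sum>t<n. c t \<bullet> out_mean A B G C \<mu> x u t)
        - of_real (cov_form (\<lambda>j. C ** mpow A j ** G) \<Psi> n c c) / 2)"
proof -
  let ?a = "conv_adj (\<lambda>j. C ** mpow A j ** G) n c"
  let ?m = "\<Sum>t<n. c t \<bullet> out_mean A B G C \<mu> x u t"
  have "(\<Sum>t<n. c t \<bullet> output_traj A B G C w \<nu> x u t \<omega>)
      = (?m - (\<Sum>t<n. ?a t \<bullet> \<mu>)) + ((\<Sum>t<n. ?a t \<bullet> w t \<omega>) + (\<Sum>t<n. c t \<bullet> \<nu> t \<omega>))" for \<omega>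
    unfolding output_traj_mean[of A B G C w \<nu> x u _ \<omega> \<mu>] inner_add_right sum.distrib
      sum_inner_convolution[where D = "\<lambda>j. C ** mpow A j ** G"]
    by (simp add: inner_diff_right sum_subtractf)
  then have "(\<integral>\<omega>. iexp (\<Sum>t<n. c t \<bullet> output_traj A B G C w \<nu> x u t \<omega>) \<partial>M)
     = (\<integral>\<omega>. iexp (?m - (\<Sum>t<n. ?a t \<bullet> \<mu>)) * iexp ((\<Sum>t<n. ?a t \<bullet> w t \<omega>) + (\<Sum>t<n. c t \<bullet> \<nu> t \<omega>)) \<partial>M)"
    by (simp only: of_real_add distrib_left exp_add)
  also have "\<dots> = iexp (?m - (\<Sum>t<n. ?a t \<bullet> \<mu>))
      * (\<integral>\<omega>. iexp ((\<Sum>t<n. ?a t \<bullet> w t \<omega>) + (\<Sum>t<n. c t \<bullet> \<nu> t \<omega>)) \<partial>M)"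
    by (rule integral_mult_right_zero)
  also have "\<dots> = exp (\<i> * of_real ?m - of_real (cov_form (\<lambda>j. C ** mpow A j ** G) \<Psi> n c c) / 2)"
    unfolding char_noise[OF nm] exp_add[symmetric] cov_form_def
    by (simp add: algebra_simps)
  finally show ?thesis .
qed

lemma exp_affine_quadratic_eq:
  fixes m1 m2 v1 v2 :: real
  assumes eq: "\<And>s::real. exp (\<i> * of_real (s * m1) - of_real (s\<^sup>2 * v1) / 2) = exp (\<i> * of_real (s * m2) - of_real (s\<^sup>2 * v2) / 2)"
  shows "m1 = m2 \<and> v1 = v2"
proof
  have "exp (- v1 / 2) = exp (- v2 / 2)"
    using arg_cong[OF eq[of 1], of norm] by simp
  then show v: "v1 = v2" by simp
  show "m1 = m2"
  proof (rule ccontr)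
    assume ne: "m1 \<noteq> m2"
    define s where "s = pi / (m1 - m2)"
    have "iexp (s * m1) = iexp (s * m2)"
      using eq[of s] unfolding v exp_diff by simp
    then have "iexp (s * m1) / iexp (s * m2) = 1" by simp
    then have "iexp (s * m1 - s * m2) = 1" by (simp add: exp_diff[symmetric] right_diff_distrib)
    moreover have "s * (m1 - m2) = pi" using ne by (simp add: s_def)
    then have "s * m1 - s * m2 = pi" by (simp only: right_diff_distrib)
    ultimately show False by simp
  qed
qed

lemma cov_form_scaleR: "cov_form D \<Psi> n (\<lambda>t. s *\<^sub>R c t) (\<lambda>t. s *\<^sub>R c t) = s\<^sup>2 * cov_form D \<Psi> n c c"
proof -
  have "conv_adj D n (\<lambda>t. s *\<^sub>R c t) \<tau> = s *\<^sub>R conv_adj D n c \<tau>" for \<tau>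
    unfolding conv_adj_def scaleR_sum_right
    by (intro sum.cong) (auto simp: matrix_vector_mult_scaleR simp del: transpose_matrix_vector)
  then show ?thesis
    by (simp add: cov_form_def sum_distrib_left distrib_left matrix_vector_mult_scaleR power2_eq_square mult.assoc)
qed

lemma cov_form_add:
  assumes "transpose \<Psi> = \<Psi>"
  shows "cov_form D \<Psi> n (\<lambda>t. c t + d t) (\<lambda>t. c t + d t) = cov_form D \<Psi> n c c + 2 * cov_form D \<Psi> n c d + cov_form D \<Psi> n d d"
proof -
  have *: "conv_adj D n (\<lambda>t. c t + d t) \<tau> = conv_adj D n c \<tau> + conv_adj D n d \<tau>" for \<tau>
    unfolding conv_adj_def sum.distrib[symmetric]
    by (intro sum.cong) (auto simp: matrix_vector_right_distrib simp del: transpose_matrix_vector)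
  have sym: "x \<bullet> (\<Psi> *v y) = y \<bullet> (\<Psi> *v x)" for x y
    using inner_transpose_mult[of \<Psi> x y] assms by (metis inner_commute)
  show ?thesis unfolding cov_form_def *
    by (simp add: inner_add_left inner_add_right matrix_vector_right_distrib sum.distrib sum_distrib_left
        inner_commute[of "conv_adj D n d _" "conv_adj D n c _"] sym[of "d _" "c _"])
qed

lemma cov_form_expand:
  "cov_form D \<Psi> n c d = (\<Sum>\<tau><n. \<Sum>t<n. \<Sum>s<n. if \<tau> < t \<and> \<tau> < s
      then c s \<bullet> ((D (s - 1 - \<tau>) ** transpose (D (t - 1 - \<tau>))) *v d t) else 0) + (\<Sum>t<n. c t \<bullet> (\<Psi> *v d t))"
  unfolding cov_form_def conv_adj_def inner_sum_left inner_sum_right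
  by (intro arg_cong2[where f = "(+)"] sum.cong refl)
    (auto simp: inner_transpose_mult matrix_vector_mul_assoc simp del: transpose_matrix_vector)

definition cov_sum :: "(nat \<Rightarrow> real^'l^'p) \<Rightarrow> nat \<Rightarrow> nat \<Rightarrow> real^'p \<Rightarrow> real^'p \<Rightarrow> real" where
  "cov_sum D p q x y = (\<Sum>\<tau><min p q. x \<bullet> ((D (p - 1 - \<tau>) ** transpose (D (q - 1 - \<tau>))) *v y))"

lemma cov_sum_Suc:
  "cov_sum D (Suc p) (Suc q) x y = x \<bullet> ((D p ** transpose (D q)) *v y) + cov_sum D p q x y"
  unfolding cov_sum_def min_Suc_Suc sum.lessThan_Suc_shift by simp

lemma cov_form_single:
  assumes "p < n" "q < n"
  shows "cov_form D \<Psi> n (\<lambda>t. if t = p then x else 0) (\<lambda>t. if t = q then y else 0)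
    = cov_sum D p q x y + (if p = q then x \<bullet> (\<Psi> *v y) else 0)"
proof -
  have adj: "conv_adj D n (\<lambda>t. if t = p then x else 0) \<tau> = (if \<tau> < p then transpose (D (p - 1 - \<tau>)) *v x else 0)"
    if "p < n" for p x \<tau>
  proof -
    have "conv_adj D n (\<lambda>t. if t = p then x else 0) \<tau>
       = (\<Sum>t<n. if t = p then (if \<tau> < p then transpose (D (p - 1 - \<tau>)) *v x else 0) else 0)"
      unfolding conv_adj_def by (intro sum.cong) (auto simp del: transpose_matrix_vector)
    then show ?thesis using that by simp
  qed
  have "(\<Sum>\<tau><n. conv_adj D n (\<lambda>t. if t = p then x else 0) \<tau> \<bullet> conv_adj D n (\<lambda>t. if t = q then y else 0) \<tau>)
     = (\<Sum>\<tau><n. if \<tau> < min p q then x \<bullet> ((D (p - 1 - \<tau>) ** transpose (D (q - 1 - \<tau>))) *v y) else 0)"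
    unfolding adj[OF assms(1)] adj[OF assms(2)]
    by (intro sum.cong) (auto simp: inner_transpose_mult matrix_vector_mul_assoc simp del: transpose_matrix_vector)
  also have "\<dots> = (\<Sum>\<tau><min p q. x \<bullet> ((D (p - 1 - \<tau>) ** transpose (D (q - 1 - \<tau>))) *v y))"
    using assms by (intro sum.mono_neutral_cong_right) auto
  moreover have "(\<Sum>t<n. (if t = p then x else 0) \<bullet> (\<Psi> *v (if t = q then y else 0)))
     = (\<Sum>t<n. if t = p then (if p = q then x \<bullet> (\<Psi> *v y) else 0) else 0)"
    by (intro sum.cong) auto
  ultimately show ?thesis using assms by (simp add: cov_form_def cov_sum_def)
qed

lemma cov_form_eq_iff:
  assumes sym: "transpose \<Psi>1 = \<Psi>1" "transpose \<Psi>2 = \<Psi>2"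
  shows "(\<forall>n c. cov_form D1 \<Psi>1 n c c = cov_form D2 \<Psi>2 n c c) \<longleftrightarrow>
    \<Psi>1 = \<Psi>2 \<and> (\<forall>h k. D1 k ** transpose (D1 h) = D2 k ** transpose (D2 h))" (is "?L \<longleftrightarrow> ?R")
proof
  assume R: ?R
  then have "D1 k ** transpose (D1 h) = D2 k ** transpose (D2 h)" for h k by blast
  with R show ?L by (simp only: cov_form_expand) simp
next
  assume L: ?L
  have polar: "cov_form D1 \<Psi>1 n c d = cov_form D2 \<Psi>2 n c d" for n c d
    using L[rule_format, of n "\<lambda>t. c t + d t"] L[rule_format, of n c] L[rule_format, of n d]
    unfolding cov_form_add[OF sym(1)] cov_form_add[OF sym(2)] by linarith
  have single: "cov_sum D1 p q x y + (if p = q then x \<bullet> (\<Psi>1 *v y) else 0) = cov_sum D2 p q x y + (if p = q then x \<bullet> (\<Psi>2 *v y) else 0)"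
    for p q x y
    using polar[of "Suc (max p q)" "\<lambda>t. if t = p then x else 0" "\<lambda>t. if t = q then y else 0"]
    by (simp add: cov_form_single)
  have \<Psi>: "\<Psi>1 = \<Psi>2"
    unfolding matrix_eq_inner using single[of 0 0] by (simp add: cov_sum_def)
  have "cov_sum D1 p q x y = cov_sum D2 p q x y" for p q x y
    using single[of p q x y] by (simp only: \<Psi> add_right_cancel)
  then have "D1 k ** transpose (D1 h) = D2 k ** transpose (D2 h)" for h k
    unfolding matrix_eq_inner using cov_sum_Suc[of D1 k h] cov_sum_Suc[of D2 k h] by (metis add_right_cancel)
  with \<Psi> show ?R by blast
qed

subsection \<open>Equivalence of external behavior\<close>

lemma stoch_equiv_output_iff:
  assumes nm1: "noise_model M1 w1 \<nu>1 \<mu>1 \<Psi>1" and nm2: "noise_model M2 w2 \<nu>2 \<mu>2 \<Psi>2"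
  shows "stoch_equiv M1 (output_traj A1 B1 G1 C1 w1 \<nu>1 x1 u) M2 (output_traj A2 B2 G2 C2 w2 \<nu>2 x2 u) \<longleftrightarrow>
    (\<forall>t. out_mean A1 B1 G1 C1 \<mu>1 x1 u t = out_mean A2 B2 G2 C2 \<mu>2 x2 u t) \<and>
    (\<forall>n c. cov_form (\<lambda>j. C1 ** mpow A1 j ** G1) \<Psi>1 n c c = cov_form (\<lambda>j. C2 ** mpow A2 j ** G2) \<Psi>2 n c c)"
    (is "?E \<longleftrightarrow> (\<forall>t. ?m1 t = ?m2 t) \<and> (\<forall>n c. ?v1 n c c = ?v2 n c c)")
proof -
  have P: "prob_space M1" "prob_space M2" using nm1 nm2 by (auto simp: noise_model_def)
  have E: "?E \<longleftrightarrow> (\<forall>n c. exp (\<i> * of_real (\<Sum>t<n. c t \<bullet> ?m1 t) - of_real (?v1 n c c) / 2)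
      = exp (\<i> * of_real (\<Sum>t<n. c t \<bullet> ?m2 t) - of_real (?v2 n c c) / 2))" (is "_ \<longleftrightarrow> ?X")
    unfolding stoch_equiv_iff_char[OF P output_traj_measurable[OF nm1] output_traj_measurable[OF nm2]]
      char_output_traj[OF nm1] char_output_traj[OF nm2] ..
  have "(\<forall>t. ?m1 t = ?m2 t) \<and> (\<forall>n c. ?v1 n c c = ?v2 n c c)" if X: ?X
  proof -
    have eq: "(\<Sum>t<n. c t \<bullet> ?m1 t) = (\<Sum>t<n. c t \<bullet> ?m2 t) \<and> ?v1 n c c = ?v2 n c c" for n c
    proof (rule exp_affine_quadratic_eq)
      fix s :: real
      show "exp (\<i> * of_real (s * (\<Sum>t<n. c t \<bullet> ?m1 t)) - of_real (s\<^sup>2 * ?v1 n c c) / 2)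
        = exp (\<i> * of_real (s * (\<Sum>t<n. c t \<bullet> ?m2 t)) - of_real (s\<^sup>2 * ?v2 n c c) / 2)"
        using X[THEN spec[of _ n], THEN spec[of _ "\<lambda>t. s *\<^sub>R c t"]]
        unfolding cov_form_scaleR inner_scaleR_left sum_distrib_left[symmetric] .
    qed
    have single: "(\<Sum>s<Suc t. (if s = t then y else 0) \<bullet> m s) = y \<bullet> m t" for y t and m :: "nat \<Rightarrow> real^'z"
      by simp
    have "y \<bullet> ?m1 t = y \<bullet> ?m2 t" for y t
      using eq[where n = "Suc t" and c = "\<lambda>s. if s = t then y else 0"] unfolding single by blast
    then have "?m1 t = ?m2 t" for t using vector_eq_ldot by blast
    with eq show ?thesis by blast
  qed
  moreover have ?X if "(\<forall>t. ?m1 t = ?m2 t) \<and> (\<forall>n c. ?v1 n c c = ?v2 n c c)"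
  proof -
    have "?m1 t = ?m2 t" "?v1 n c c = ?v2 n c c" for t n c using that by blast+
    then show ?thesis by (simp only: simp_thms)
  qed
  ultimately show ?thesis unfolding E by (rule iffI)
qed

lemma in_obs_ker_Suc:
  "in_obs_ker (Suc k) A1 C1 A2 C2 x \<longleftrightarrow> C1 *v fst x = C2 *v snd x \<and> in_obs_ker k A1 C1 A2 C2 (diag_act A1 A2 x)"
proof -
  have mpow_Suc: "mpow A (Suc j) = mpow A j ** A" for A :: "real^'n^'n" and j
    by (induction j) (simp_all add: mpow_def matrix_mul_assoc)
  show ?thesis
    unfolding in_obs_ker_def All_less_Suc2 mpow_Suc diag_act_def
    by (simp add: mpow_def matrix_vector_mul_assoc matrix_mul_assoc)
qed

lemma subspace_in_obs_ker: "subspace {x. in_obs_ker k A1 C1 A2 C2 x}"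
  by (auto simp: subspace_def in_obs_ker_def matrix_vector_right_distrib matrix_vector_mult_scaleR)

text \<open>The kernels decrease with \<open>k\<close> and stay constant once two consecutive ones agree; since the
  dimension can drop at most \<open>n\<^sub>1 + n\<^sub>2\<close> times, no Cayley-Hamilton theorem is needed.\<close>

lemma in_obs_ker_stabilizes:
  fixes A1 :: "real^'n1^'n1" and A2 :: "real^'n2^'n2"
  assumes "in_obs_ker (CARD('n1) + CARD('n2)) A1 C1 A2 C2 x"
  shows "in_obs_ker j A1 C1 A2 C2 x"
proof -
  define V where "V k = {x. in_obs_ker k A1 C1 A2 C2 x}" for k
  have anti: "V k \<subseteq> V j" if "j \<le> k" for j k using that by (auto simp: V_def in_obs_ker_def)
  have dim: "dim (V k) + k \<le> CARD('n1) + CARD('n2)" if "\<forall>j<k. V (Suc j) \<noteq> V j" for k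
    using that
  proof (induction k)
    case 0
    show ?case using dim_subset_UNIV[of "V 0"] by simp
  next
    case (Suc k)
    have "V (Suc k) \<subset> V k" using Suc.prems anti[of k "Suc k"] by auto
    moreover have "span (V j) = V j" for j
      unfolding V_def by (intro span_eq_iff[THEN iffD2] subspace_in_obs_ker)
    ultimately have "dim (V (Suc k)) < dim (V k)"
      by (intro dim_psubset) (simp only:)
    with Suc show ?case by simp
  qed
  obtain k where k: "k \<le> CARD('n1) + CARD('n2)" "V (Suc k) = V k"
  proof (rule ccontr)
    assume "\<not> thesis"
    then have "\<forall>k<Suc (CARD('n1) + CARD('n2)). V (Suc k) \<noteq> V k" using that by (auto simp: less_Suc_eq_le)
    from dim[OF this] show False by simp
  qed
  have "V (k + i) = V k" for i
  proof (induction i)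
    case (Suc i)
    have "V (Suc (k + i)) = V (Suc k)"
      using Suc unfolding V_def in_obs_ker_Suc by blast
    with k show ?case by simp
  qed simp
  then have "V (CARD('n1) + CARD('n2)) \<subseteq> V j"
    using k(1) anti[of j k] anti[of k j] by (metis le_add_diff_inverse linear order_refl)
  with assms show ?thesis by (auto simp: V_def)
qed

lemma sum_lessThan_diff_eqD:
  fixes E1 E2 :: "nat \<Rightarrow> 'a::ab_group_add"
  assumes "\<And>t. (\<Sum>\<tau><t. E1 (t - 1 - \<tau>)) = (\<Sum>\<tau><t. E2 (t - 1 - \<tau>))"
  shows "E1 j = E2 j"
proof -
  have "(\<Sum>\<tau><t. E1 \<tau>) = (\<Sum>\<tau><t. E2 \<tau>)" for t
    using assms[of t] sum.nat_diff_reindex[of E1 t] sum.nat_diff_reindex[of E2 t] by simp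
  from this[of j] this[of "Suc j"] show ?thesis by simp
qed

lemma out_mean_eq_iff:
  fixes A1 :: "real^'n1^'n1" and A2 :: "real^'n2^'n2" and B1 :: "real^'m^'n1"
  assumes R: "(0, 0) \<in> R"
  shows "(\<forall>x1 x2 u t. (x1, x2) \<in> R \<longrightarrow> out_mean A1 B1 G1 C1 \<mu>1 x1 u t = out_mean A2 B2 G2 C2 \<mu>2 x2 u t) \<longleftrightarrow>
    (\<forall>t. C1 ** mpow A1 t ** B1 = C2 ** mpow A2 t ** B2) \<and>
    (\<forall>t. C1 ** mpow A1 t ** G1 *v \<mu>1 = C2 ** mpow A2 t ** G2 *v \<mu>2) \<and>
    (\<forall>x\<in>R. in_obs_ker (CARD('n1) + CARD('n2)) A1 C1 A2 C2 x)" (is "?L \<longleftrightarrow> ?B \<and> ?G \<and> ?K")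
proof
  assume L: ?L
  have G: "C1 ** mpow A1 t ** G1 *v \<mu>1 = C2 ** mpow A2 t ** G2 *v \<mu>2" for t
  proof (rule sum_lessThan_diff_eqD[where ?E1.0 = "\<lambda>t. C1 ** mpow A1 t ** G1 *v \<mu>1"])
    show "(\<Sum>\<tau><t. C1 ** mpow A1 (t - 1 - \<tau>) ** G1 *v \<mu>1) = (\<Sum>\<tau><t. C2 ** mpow A2 (t - 1 - \<tau>) ** G2 *v \<mu>2)" for t
      using L[rule_format, OF R, of "\<lambda>_. 0" t] by (simp add: out_mean_def)
  qed
  have B: "C1 ** mpow A1 t ** B1 = C2 ** mpow A2 t ** B2" for t
    unfolding matrix_eq
  proof
    fix z
    have *: "(\<Sum>\<tau><Suc t. P (Suc t - 1 - \<tau>) *v (if \<tau> = 0 then z else 0)) = P t *v z"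
      for P :: "nat \<Rightarrow> real^'m^'q"
    proof -
      have "(\<Sum>\<tau><Suc t. P (Suc t - 1 - \<tau>) *v (if \<tau> = 0 then z else 0)) = (\<Sum>\<tau><Suc t. if \<tau> = 0 then P t *v z else 0)"
        by (intro sum.cong) auto
      then show ?thesis by simp
    qed
    show "C1 ** mpow A1 t ** B1 *v z = C2 ** mpow A2 t ** B2 *v z"
      using L[rule_format, OF R, of "\<lambda>\<tau>. if \<tau> = 0 then z else 0" "Suc t"]
      unfolding out_mean_def *[of "\<lambda>j. C1 ** mpow A1 j ** B1"] *[of "\<lambda>j. C2 ** mpow A2 j ** B2"] G by simp
  qed
  have "in_obs_ker (CARD('n1) + CARD('n2)) A1 C1 A2 C2 (x1, x2)" if "(x1, x2) \<in> R" for x1 x2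
    unfolding in_obs_ker_def using L[rule_format, OF that, of "\<lambda>_. 0"] G by (simp add: out_mean_def)
  with B G show "?B \<and> ?G \<and> ?K" by auto
next
  assume *: "?B \<and> ?G \<and> ?K"
  then have B: "C1 ** mpow A1 t ** B1 = C2 ** mpow A2 t ** B2"
    and G: "C1 ** mpow A1 t ** G1 *v \<mu>1 = C2 ** mpow A2 t ** G2 *v \<mu>2" for t by blast+
  have K: "C1 ** mpow A1 t *v x1 = C2 ** mpow A2 t *v x2" if "(x1, x2) \<in> R" for x1 x2 t
    using in_obs_ker_stabilizes[of A1 C1 A2 C2 "(x1, x2)" "Suc t"] * that by (auto simp: in_obs_ker_def)
  show ?L
    by (intro allI impI) (simp only: out_mean_def B G K)
qed

lemma equiv_ext_beh_iff:
  fixes A1 :: "real^'n1^'n1" and A2 :: "real^'n2^'n2"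
  assumes nm1: "noise_model M1 w1 \<nu>1 \<mu>1 \<Psi>1" and nm2: "noise_model M2 w2 \<nu>2 \<mu>2 \<Psi>2" and R: "(0, 0) \<in> R"
  shows "equiv_ext_beh M1 A1 B1 G1 C1 w1 \<nu>1 M2 A2 B2 G2 C2 w2 \<nu>2 R \<longleftrightarrow>
            \<Psi>1 = \<Psi>2 \<and>
            (\<forall>t. C1 ** mpow A1 t ** B1 = C2 ** mpow A2 t ** B2) \<and>
            (\<forall>t. C1 ** mpow A1 t ** G1 *v \<mu>1 = C2 ** mpow A2 t ** G2 *v \<mu>2) \<and>
            (\<forall>h k. C1 ** mpow A1 k ** G1 ** transpose G1 ** transpose (mpow A1 h) ** transpose C1 =
                   C2 ** mpow A2 k ** G2 ** transpose G2 ** transpose (mpow A2 h) ** transpose C2) \<and>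
            (\<forall>x\<in>R. in_obs_ker (CARD('n1) + CARD('n2)) A1 C1 A2 C2 x)"
proof -
  have sym: "transpose \<Psi>1 = \<Psi>1" "transpose \<Psi>2 = \<Psi>2"
    using nm1 nm2 by (auto simp: noise_model_def gaussian_vec_def)
  have tr: "C ** mpow A k ** G ** transpose G ** transpose (mpow A h) ** transpose C
      = (C ** mpow A k ** G) ** transpose (C ** mpow A h ** G)"
    for A :: "real^'n^'n" and C :: "real^'n^'p" and G :: "real^'l^'n" and h k
    by (simp add: matrix_transpose_mul matrix_mul_assoc)
  have "equiv_ext_beh M1 A1 B1 G1 C1 w1 \<nu>1 M2 A2 B2 G2 C2 w2 \<nu>2 R \<longleftrightarrow>
     (\<forall>x1 x2 u t. (x1, x2) \<in> R \<longrightarrow> out_mean A1 B1 G1 C1 \<mu>1 x1 u t = out_mean A2 B2 G2 C2 \<mu>2 x2 u t) \<and>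
    (\<forall>n c. cov_form (\<lambda>j. C1 ** mpow A1 j ** G1) \<Psi>1 n c c = cov_form (\<lambda>j. C2 ** mpow A2 j ** G2) \<Psi>2 n c c)"
    unfolding equiv_ext_beh_def stoch_equiv_output_iff[OF nm1 nm2] using R by blast
  then show ?thesis
    unfolding out_mean_eq_iff[OF R] cov_form_eq_iff[OF sym] tr by blast
qed

theorem theorem1:
  fixes M1 :: "'a measure" and M2 :: "'b measure"
    and A1 :: "real^'n1^'n1" and B1 :: "real^'m^'n1" and G1 :: "real^'l1^'n1" and C1 :: "real^'n1^'p"
    and A2 :: "real^'n2^'n2" and B2 :: "real^'m^'n2" and G2 :: "real^'l2^'n2" and C2 :: "real^'n2^'p"
    and w1 :: "nat \<Rightarrow> 'a \<Rightarrow> real^'l1" and \<nu>1 :: "nat \<Rightarrow> 'a \<Rightarrow> real^'p"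
    and w2 :: "nat \<Rightarrow> 'b \<Rightarrow> real^'l2" and \<nu>2 :: "nat \<Rightarrow> 'b \<Rightarrow> real^'p"
    and \<mu>1 :: "real^'l1" and \<mu>2 :: "real^'l2" and \<Psi>1 \<Psi>2 :: "real^'p^'p"
    and R :: "((real^'n1) \<times> (real^'n2)) set"
  assumes noise1: "noise_model M1 w1 \<nu>1 \<mu>1 \<Psi>1"
    and noise2: "noise_model M2 w2 \<nu>2 \<mu>2 \<Psi>2"
    and R: "subspace R"
  defines "n \<equiv> CARD('n1) + CARD('n2)"
  shows "(equiv_ext_beh M1 A1 B1 G1 C1 w1 \<nu>1 M2 A2 B2 G2 C2 w2 \<nu>2 R \<longleftrightarrow>
            \<Psi>1 = \<Psi>2 \<and>
            (\<forall>t. C1 ** mpow A1 t ** B1 = C2 ** mpow A2 t ** B2) \<and>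
            (\<forall>t. C1 ** mpow A1 t ** G1 *v \<mu>1 = C2 ** mpow A2 t ** G2 *v \<mu>2) \<and>
            (\<forall>h k. C1 ** mpow A1 k ** G1 ** transpose G1 ** transpose (mpow A1 h) ** transpose C1 =
                   C2 ** mpow A2 k ** G2 ** transpose G2 ** transpose (mpow A2 h) ** transpose C2) \<and>
            (\<forall>x\<in>R. in_obs_ker n A1 C1 A2 C2 x))
       \<and> (equiv_ext_beh M1 A1 B1 G1 C1 w1 \<nu>1 M2 A2 B2 G2 C2 w2 \<nu>2 R \<longrightarrow>
            (\<exists>R'. subspace R' \<and> R \<subseteq> R' \<and> diag_act A1 A2 ` R' \<subseteq> R' \<and>
                  equiv_ext_beh M1 A1 B1 G1 C1 w1 \<nu>1 M2 A2 B2 G2 C2 w2 \<nu>2 R'))"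
proof -
  have R0: "(0, 0) \<in> R" using subspace_0[OF R] by (simp add: zero_prod_def)
  note iff = equiv_ext_beh_iff[OF noise1 noise2]
  define R' where "R' = {x. in_obs_ker n A1 C1 A2 C2 x}"
  have R': "subspace R'" unfolding R'_def by (rule subspace_in_obs_ker)
  have R'0: "(0, 0) \<in> R'" using subspace_0[OF R'] by (simp add: zero_prod_def)
  have "diag_act A1 A2 x \<in> R'" if "x \<in> R'" for x
    using in_obs_ker_stabilizes[of A1 C1 A2 C2 x "Suc n"] that
    unfolding R'_def in_obs_ker_Suc n_def by simp
  then have inv: "diag_act A1 A2 ` R' \<subseteq> R'" by blast
  have ext: "R \<subseteq> R' \<and> equiv_ext_beh M1 A1 B1 G1 C1 w1 \<nu>1 M2 A2 B2 G2 C2 w2 \<nu>2 R'"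
    if "equiv_ext_beh M1 A1 B1 G1 C1 w1 \<nu>1 M2 A2 B2 G2 C2 w2 \<nu>2 R"
    using that unfolding iff[OF R0] iff[OF R'0] unfolding R'_def n_def by blast
  show ?thesis
  proof (intro conjI impI)
    assume "equiv_ext_beh M1 A1 B1 G1 C1 w1 \<nu>1 M2 A2 B2 G2 C2 w2 \<nu>2 R"
    with ext R' inv show "\<exists>R'. subspace R' \<and> R \<subseteq> R' \<and> diag_act A1 A2 ` R' \<subseteq> R' \<and>
        equiv_ext_beh M1 A1 B1 G1 C1 w1 \<nu>1 M2 A2 B2 G2 C2 w2 \<nu>2 R'" by blast
  qed (unfold n_def, rule iff[OF R0])
qed

end
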